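(* Let $D=(D_T,D_F)$ be an $(s^{n-k}:s^p)$ RME design, and let $D_{\mathrm{un}}$ be the unblocked regular $s^{(n+L_p)-(k+L_p)}$ design obtained by viewing all $n+L_p$ columns of $(D_T,D_F)$ as treatment columns. If $D_T$ has minimum aberration (MA) among all regular $s^{n-k}$ designs and $D_{\mathrm{un}}$ has MA among all regular $s^{(n+L_p)-(k+L_p)}$ designs, then $D$ has MA with respect to each of $W_{\mathrm{scf}}$, $W_1$, $W_2$ and $W_{\mathrm{cc}}$.
   Context: Let $s$ be a prime power, $GF(s)$ the field with $s$ elements, and $V_m$ the space of row vectors of length $m$ over $GF(s)$. Let $n,k,p$ be integers with $n\ge1$, $k\ge0$, $n-k\ge 1$, $p\ge 1$; write $N=s^{n-k}$ and $L_q=(s^q-1)/(s-1)$. Designs. A regular $s^{n-k}$ design is the $N\times n$ matrix $D_T$ whose rows are the vectors $uT$, $u\in V_{n-k}$, where $T$ is an $(n-k)\times n$ matrix over $GF(s)$ of full row rank. A regular $(s^{n-k}:s^p)$ design $D$ is specified by such a $T$ together with an $(n-k)\times p$ matrix $B$ over $GF(s)$ of full column rank; its blocks are the sets $\{uT: u\in V_{n-k},\,uB=v\}$, one for each $v\in V_p$. If $b_1,\dots,b_p$ are the columns of $B$, let $F$ be the $(n-k)\times L_p$ matrix whose columns are all combinations $\lambda_1b_1+\cdots+\lambda_pb_p$ with $\lambda_i\in GF(s)$, not all zero, the first nonzero $\lambda_i$ being $1$. Let $D_F$ be the $N\times L_p$ matrix with rows $uF$, $u\in V_{n-k}$ (same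 ordering of $u$ as in $D_T$). One writes $D=(D_T,D_F)$. The design $D_{\mathrm{un}}$ is the regular $s^{(n+L_p)-(k+L_p)}$ design with generator matrix $(T,F)$. Wordlength patterns. Let $wt$ denote the Hamming weight. $A_{i,0}=(s-1)^{-1}\#\{w\in V_n: Tw'=0,\ wt(w)=i\}$ and $A_{i,1}=(s-1)^{-1}\#\{(w_1,w_2)\in V_n\times V_{L_p}: Tw_1'+Fw_2'=0,\ wt(w_1)=i,\ wt(w_2)=1\}$ (both are $0$ for $i>n$). $D$ is a regular main effect (RME) design if $A_{1,0}(D)=A_{2,0}(D)=A_{1,1}(D)=0$. Minimum aberration. A regular unblocked design with $m$ columns has MA among a class of regular designs with the same $s$, number of runs and number $m$ of columns if it sequentially (lexicographically) minimizes $A_{1,0},A_{2,0},\dots,A_{m,0}$ over the class (where $A_{i,0}$ is computed from its own generator matrix by the formula above). For blocked designs, consider the sequences $W_{\mathrm{scf}}=(A_{3,0},A_{2,1},A_{4,0},A_{3,1},A_{5,0},A_{4,1},\dots)$ (successive pairs $A_{i+1,0},A_{i,1}$, $i=2,3,\dots$); $W_{\mathrm{cc}}=(3A_{3,0}+A_{2,1},A_{4,0},10A_{5,0}+A_{3,1},A_{6,0},\dots)$ (successive pairs $\binom{2i-1}{i}A_{2i-1,0}+A_{i,1},\ A_{2i,0}$, $i=2,3,\dots$); $W_1=(A_{3,0},A_{4,0},A_{2,1},A_{5,0},A_{6,0},A_{3,1},\dots)$ (successive triples $A_{2i-1,0},A_{2i,0},A_{i,1}$, $i=2,3,\dots$);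 $W_2=(A_{3,0},A_{2,1},A_{4,0},A_{5,0},A_{3,1},A_{6,0},\dots)$ (successive triples $A_{2i-1,0},A_{i,1},A_{2i,0}$, $i=2,3,\dots$). An $(s^{n-k}:s^p)$ RME design has MA with respect to one of these sequences $W$ if it lexicographically minimizes $W$ among all $(s^{n-k}:s^p)$ RME designs (same $s,n,k,p$). *)

theory Defs
  imports "HOL-Library.Cardinality" "Jordan_Normal_Form.DL_Rank" "HOL-Library.Fun_Lexorder"
begin

text \<open>
  The field of order $s$ is a type of class \<open>{field, finite}\<close>, so $s$ is \<open>CARD('a)\<close>.
  A regular design is represented by its generator matrix, and a regular blocked design by a
  triple (T, B, F): the runs are the vectors u T and the blocks are the fibres of u B, where u ranges
  over all row vectors of length n - k, while the columns of F are the normalized combinations of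
  the columns of B, i.e. the block main effects and their interactions. Wordlength patterns, and hence all aberration criteria, are functions of
  these matrices. Vectors of the matrix library are columns, so a word w is a vector of
  dimension \<open>dim_col T\<close> and the condition T w' = 0 becomes \<open>T *\<^sub>v w = 0\<^sub>v (dim_row T)\<close>.
\<close>

definition hamming_wt :: "'a::zero vec \<Rightarrow> nat" where
  "hamming_wt w = card {i. i < dim_vec w \<and> w $ i \<noteq> 0}"

definition num_effects :: "nat \<Rightarrow> nat \<Rightarrow> nat" where
  "num_effects s q = (s ^ q - 1) div (s - 1)"  \<comment> \<open>the division is exact for $s > 1$\<close>

definition regular_design :: "nat \<Rightarrow> nat \<Rightarrow> 'a::{field,finite} mat \<Rightarrow> bool" where
  "regular_design n k T \<longleftrightarrow>
     T \<in> carrier_mat (n - k) n \<and> vec_space.rank (n - k) T = n - k"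

definition normalized_vecs :: "nat \<Rightarrow> 'a::{field,finite} vec set" where
  "normalized_vecs p = {l \<in> carrier_vec p. \<exists>i<p. l $ i = 1 \<and> (\<forall>j<i. l $ j = 0)}"

text \<open>The columns of F may be listed in any order, which is why this is a relation.\<close>

definition block_effects :: "nat \<Rightarrow> 'a::{field,finite} mat \<Rightarrow> 'a mat \<Rightarrow> bool" where
  "block_effects p B F \<longleftrightarrow>
     (\<exists>ls. distinct ls \<and> set ls = normalized_vecs p \<and>
           F = mat_of_cols (dim_row B) (map (\<lambda>l. B *\<^sub>v l) ls))"

definition regular_blocked_design ::
    "nat \<Rightarrow> nat \<Rightarrow> nat \<Rightarrow> 'a::{field,finite} mat \<Rightarrow> 'a mat \<Rightarrow> 'a mat \<Rightarrow> bool" where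
  "regular_blocked_design n k p T B F \<longleftrightarrow>
     regular_design n k T \<and>
     B \<in> carrier_mat (n - k) p \<and> vec_space.rank (n - k) B = p \<and>
     block_effects p B F"

definition unblocked_gen :: "'a::{field,finite} mat \<Rightarrow> 'a mat \<Rightarrow> 'a mat" where
  "unblocked_gen T F = mat_of_cols (dim_row T) (cols T @ cols F)"

definition A0 :: "'a::{field,finite} mat \<Rightarrow> nat \<Rightarrow> real" where
  "A0 T i =
     real (card {w \<in> carrier_vec (dim_col T).
                   T *\<^sub>v w = 0\<^sub>v (dim_row T) \<and> hamming_wt w = i})
     / real (CARD('a) - 1)"

definition A1 :: "'a::{field,finite} mat \<Rightarrow> 'a mat \<Rightarrow> nat \<Rightarrow> real" where
  "A1 T F i =
     real (card {(w1, w2). w1 \<in> carrier_vec (dim_col T) \<and> w2 \<in> carrier_vec (dim_col F) \<and>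
                   T *\<^sub>v w1 + F *\<^sub>v w2 = 0\<^sub>v (dim_row T) \<and>
                   hamming_wt w1 = i \<and> hamming_wt w2 = 1})
     / real (CARD('a) - 1)"

definition rme_design ::
    "nat \<Rightarrow> nat \<Rightarrow> nat \<Rightarrow> 'a::{field,finite} mat \<Rightarrow> 'a mat \<Rightarrow> 'a mat \<Rightarrow> bool" where
  "rme_design n k p T B F \<longleftrightarrow>
     regular_blocked_design n k p T B F \<and> A0 T 1 = 0 \<and> A0 T 2 = 0 \<and> A1 T F 1 = 0"

definition lex_le :: "(nat \<Rightarrow> real) \<Rightarrow> (nat \<Rightarrow> real) \<Rightarrow> bool" where
  "lex_le f g \<longleftrightarrow> less_fun f g \<or> f = g"

text \<open>
  The wordlength pattern of a design with n columns is the infinite sequence starting at length 1;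
  its entries beyond length n are 0, so the comparison is that of the first n entries.
\<close>

definition min_aberration :: "nat \<Rightarrow> nat \<Rightarrow> 'a::{field,finite} mat \<Rightarrow> bool" where
  "min_aberration n k T \<longleftrightarrow>
     regular_design n k T \<and>
     (\<forall>T' :: 'a mat. regular_design n k T' \<longrightarrow>
        lex_le (\<lambda>j. A0 T (j + 1)) (\<lambda>j. A0 T' (j + 1)))"

text \<open>
  In the sequences below, position j (counted from 0) belongs to the successive pair or triple
  with index \<open>i = j div 2 + 2\<close> or \<open>i = j div 3 + 2\<close>.
\<close>

definition W_scf :: "'a::{field,finite} mat \<Rightarrow> 'a mat \<Rightarrow> nat \<Rightarrow> real" where
  "W_scf T F j = (let i = j div 2 + 2 in
     if j mod 2 = 0 then A0 T (i + 1) else A1 T F i)"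

definition W_cc :: "'a::{field,finite} mat \<Rightarrow> 'a mat \<Rightarrow> nat \<Rightarrow> real" where
  "W_cc T F j = (let i = j div 2 + 2 in
     if j mod 2 = 0 then real ((2 * i - 1) choose i) * A0 T (2 * i - 1) + A1 T F i
     else A0 T (2 * i))"

definition W_1 :: "'a::{field,finite} mat \<Rightarrow> 'a mat \<Rightarrow> nat \<Rightarrow> real" where
  "W_1 T F j = (let i = j div 3 + 2 in
     if j mod 3 = 0 then A0 T (2 * i - 1)
     else if j mod 3 = 1 then A0 T (2 * i)
     else A1 T F i)"

definition W_2 :: "'a::{field,finite} mat \<Rightarrow> 'a mat \<Rightarrow> nat \<Rightarrow> real" where
  "W_2 T F j = (let i = j div 3 + 2 in
     if j mod 3 = 0 then A0 T (2 * i - 1)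
     else if j mod 3 = 1 then A1 T F i
     else A0 T (2 * i))"

definition blocked_min_aberration ::
    "('a::{field,finite} mat \<Rightarrow> 'a mat \<Rightarrow> nat \<Rightarrow> real) \<Rightarrow>
     nat \<Rightarrow> nat \<Rightarrow> nat \<Rightarrow> 'a mat \<Rightarrow> 'a mat \<Rightarrow> 'a mat \<Rightarrow> bool" where
  "blocked_min_aberration W n k p T B F \<longleftrightarrow>
     rme_design n k p T B F \<and>
     (\<forall>T' B' F'. rme_design n k p T' B' F' \<longrightarrow> lex_le (W T F) (W T' F'))"

end

theory Submission
  imports Defs
begin

text \<open>
  Let $G$ be the matrix whose columns are the points of the projective space of $V_p$. Then $F = BG$, and
  $G$ is the parity check matrix of a Hamming code. Hence the words $(w_1, w_2)$ of $D_{un}$ can be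
  sorted by the syndrome $v = G w_2'$: the condition becomes $T w_1' + B v = 0$, and for given $v$ the
  number of $w_2$ of weight $j$ is the weight distribution of a coset of the Hamming code. The
  general linear group is transitive on nonzero vectors and permutes the points, so this number takes
  one value $c_j$ for $v = 0$ and one value $d_j$ for all $v \<noteq> 0$ (lemma \<open>nonparallel_count_nonzero_eq\<close>).
  Grouping the words yields
  $A_m(D_{un}) = \sum_{j \<le> m} (c_j A_{m-j,0} + d_j A_{m-j,1})$,
  where $c_j$ and $d_j$ are the same for all designs, $c_0 = d_1 = 1$ and $c_1 = d_0 = 0$ (lemmas
  \<open>A0_unblocked\<close> and \<open>A0_unblocked_Suc\<close>). So if two designs agree in $A_{i,0}$ for
  $i \<le> m$ and in $A_{i,1}$ for $i < m$, their unblocked patterns differ at $m + 1$ by exactly the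
  difference of $A_{m+1,0} + A_{m,1}$, and $D_{un}$ minimizes this sum (lemma \<open>min_aberration_sum_le\<close>).

  Now compare $D$ with another RME design, at the first entry of a sequence where they may differ.
  If the entry is some $A_{i,0}$, all earlier $A_{.,0}$ agree and minimum aberration of $D_T$ applies. If it
  is some $A_{i,1}$, then $A_{i+1,0}$ has been compared before and agrees, so minimality of
  $A_{i+1,0} + A_{i,1}$ is minimality of $A_{i,1}$. The remaining entries, the linear combinations in
  $W_{cc}$, have a coefficient greater than 1 at $A_{2i-1,0}$ and are handled by lemma
  \<open>W_cc_step\<close>. The comparison is started by the RME property, together with the trivial values at
  length 0.
\<close>

section \<open>Coset weight distributions of the Hamming code\<close>

lemma finite_carrier_vec: "finite (carrier_vec n :: 'a::finite vec set)"
proof (rule finite_subset)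
  show "carrier_vec n \<subseteq> vec_of_list ` {xs :: 'a list. set xs \<subseteq> UNIV \<and> length xs = n}"
  proof
    fix x :: "'a vec"
    assume "x \<in> carrier_vec n"
    then show "x \<in> vec_of_list ` {xs. set xs \<subseteq> UNIV \<and> length xs = n}"
      by (intro image_eqI[of _ _ "list_of_vec x"]) (auto simp: vec_list)
  qed
qed (intro finite_imageI finite_lists_length_eq, simp)

text \<open>
  A vector $w$ indexed by the points of the projective space of $V_p$ is encoded by the set
  of its scaled points $w_i l_i$, $w_i \<noteq> 0$. The sets arising in this way are those whose members are
  nonzero and pairwise nonproportional: a description that mentions neither representatives nor
  their order, so that linear maps act on it.
\<close>

definition nonparallel_sets :: "nat \<Rightarrow> 'a::{field,finite} vec set set" where
  "nonparallel_sets p = {S. S \<subseteq> carrier_vec p - {0\<^sub>v p} \<and>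
                    (\<forall>x\<in>S. \<forall>y\<in>S. \<forall>a. y = a \<cdot>\<^sub>v x \<longrightarrow> x = y)}"

text \<open>
  Defined componentwise because vectors of unspecified dimension form no additive monoid.
\<close>

definition vec_sum :: "nat \<Rightarrow> 'a::comm_monoid_add vec set \<Rightarrow> 'a vec" where
  "vec_sum p S = vec p (\<lambda>c. \<Sum>x\<in>S. x $ c)"

text \<open>
  The weight distribution of a coset of the Hamming code: the number of vectors of weight $j$ and
  syndrome $v$ (lemma \<open>coset_weight_count\<close>).
\<close>

definition nonparallel_count :: "'a::{field,finite} itself \<Rightarrow> nat \<Rightarrow> nat \<Rightarrow> 'a vec \<Rightarrow> nat" where
  "nonparallel_count _ p j v = card {S \<in> nonparallel_sets p. card S = j \<and> vec_sum p S = v}"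

lemma finite_nonparallel_sets: "finite (nonparallel_sets p :: 'a::{field,finite} vec set set)"
  by (rule finite_subset[of _ "Pow (carrier_vec p)"])
     (auto simp: nonparallel_sets_def finite_carrier_vec)

lemma nonparallel_sets_carrier: "S \<in> nonparallel_sets p \<Longrightarrow> S \<subseteq> carrier_vec p"
  unfolding nonparallel_sets_def by blast

lemma finite_nonparallel_set: "S \<in> nonparallel_sets p \<Longrightarrow> finite S"
  by (auto simp: nonparallel_sets_def intro: finite_subset[OF _ finite_carrier_vec])

lemma normalized_vecs_props:
  assumes "l \<in> normalized_vecs p"
  shows "l \<in> carrier_vec p" "l \<noteq> 0\<^sub>v p"
  using assms by (auto simp: normalized_vecs_def)

lemma normalized_vecs_unique:
  assumes "l \<in> normalized_vecs p" "l' \<in> normalized_vecs p" "l' = a \<cdot>\<^sub>v l"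
  shows "l' = l" "a = 1"
proof -
  obtain i where i: "i < p" "l $ i = 1" "\<forall>j<i. l $ j = 0" and l: "l \<in> carrier_vec p"
    using assms(1) by (auto simp: normalized_vecs_def)
  obtain i' where i': "i' < p" "l' $ i' = 1" "\<forall>j<i'. l' $ j = 0"
    using assms(2) by (auto simp: normalized_vecs_def)
  have e: "l' $ j = a * l $ j" if "j < p" for j
    using that l assms(3) by auto
  have "i = i'"
  proof (rule linorder_cases[of i i'])
    assume "i < i'"
    then have "a = 0" using e[OF i(1)] i(2) i'(3) by simp
    then show ?thesis using e[OF i'(1)] i'(2) by simp
  next
    assume "i' < i"
    then show ?thesis using e[OF i'(1)] i'(2) i(3) by simp
  qed
  then show a: "a = 1" using e[OF i(1)] i(2) i'(2) by simp
  show "l' = l" using assms(3) a by simp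
qed

lemma normalized_vecs_representative:
  fixes x :: "'a::{field,finite} vec"
  assumes "x \<in> carrier_vec p" "x \<noteq> 0\<^sub>v p"
  obtains a l where "a \<noteq> 0" "l \<in> normalized_vecs p" "x = a \<cdot>\<^sub>v l"
proof -
  have "\<exists>i. i < p \<and> x $ i \<noteq> 0"
  proof (rule ccontr)
    assume "\<not> ?thesis"
    then have "x = 0\<^sub>v p" using assms(1) by (intro eq_vecI) auto
    then show False using assms(2) by simp
  qed
  then obtain i where i: "i < p" "x $ i \<noteq> 0" and min: "\<forall>j<i. \<not> (j < p \<and> x $ j \<noteq> 0)"
    using exists_least_iff[of "\<lambda>i. i < p \<and> x $ i \<noteq> 0"] by blast
  define l where "l = (1 / x $ i) \<cdot>\<^sub>v x"
  have "l \<in> normalized_vecs p"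
    unfolding normalized_vecs_def using assms(1) i min
    by (auto simp: l_def intro!: exI[of _ i])
  moreover have "x = x $ i \<cdot>\<^sub>v l"
    using i assms(1) by (auto simp: l_def smult_smult_assoc)
  ultimately show ?thesis using that i by blast
qed

definition weighted_cols :: "'a::field vec list \<Rightarrow> 'a vec \<Rightarrow> 'a vec set" where
  "weighted_cols ls w = (\<lambda>i. w $ i \<cdot>\<^sub>v ls ! i) ` {i. i < length ls \<and> w $ i \<noteq> 0}"

context
  fixes p :: nat and ls :: "'a::{field,finite} vec list"
  assumes dist: "distinct ls" and ls: "set ls = normalized_vecs p"
begin

text \<open>
  Normalized vectors represent each point once, so a scaled point determines both its position in
  the list and its scalar.
\<close>

lemma weighted_cols_eqD:
  assumes "i < length ls" "j < length ls" "a \<noteq> 0" "a \<cdot>\<^sub>v ls ! i = b \<cdot>\<^sub>v ls ! j"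
  shows "i = j" "a = b"
proof -
  have c: "ls ! i \<in> normalized_vecs p" "ls ! j \<in> normalized_vecs p"
    using assms(1,2) ls nth_mem by blast+
  have "ls ! i = (1 / a) \<cdot>\<^sub>v (a \<cdot>\<^sub>v ls ! i)"
    using assms(3) by (simp add: smult_smult_assoc)
  also have "\<dots> = (b / a) \<cdot>\<^sub>v ls ! j"
    using assms(4) by (simp add: smult_smult_assoc)
  finally have e: "ls ! i = (b / a) \<cdot>\<^sub>v ls ! j" .
  show "i = j"
    using normalized_vecs_unique(1)[OF c(2,1) e] dist assms(1,2) by (simp add: nth_eq_iff_index_eq)
  show "a = b"
    using normalized_vecs_unique(2)[OF c(2,1) e] assms(3) by simp
qed

lemma inj_on_weighted_cols: "inj_on (\<lambda>i. w $ i \<cdot>\<^sub>v ls ! i) {i. i < length ls \<and> w $ i \<noteq> 0}"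
proof (rule inj_onI, clarify)
  fix i j
  assume "i < length ls" "j < length ls" "w $ i \<noteq> 0" "w $ i \<cdot>\<^sub>v ls ! i = w $ j \<cdot>\<^sub>v ls ! j"
  then show "i = j" by (rule weighted_cols_eqD(1))
qed

lemma card_weighted_cols:
  "w \<in> carrier_vec (length ls) \<Longrightarrow> card (weighted_cols ls w) = hamming_wt w"
  unfolding weighted_cols_def hamming_wt_def 
  by (subst card_image[OF inj_on_weighted_cols]) (metis carrier_vecD)

lemma vec_sum_weighted_cols:
  assumes "w \<in> carrier_vec (length ls)"
  shows "vec_sum p (weighted_cols ls w) = mat_of_cols p ls *\<^sub>v w"
proof (rule eq_vecI)
  fix c assume "c < dim_vec (mat_of_cols p ls *\<^sub>v w)"
  then have c: "c < p" by simp
  have d: "dim_vec (ls ! i) = p" if "i < length ls" for i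
    using that ls nth_mem[OF that] normalized_vecs_props(1) by (metis carrier_vecD)
  have "vec_sum p (weighted_cols ls w) $ c
      = (\<Sum>i | i < length ls \<and> w $ i \<noteq> 0. (w $ i \<cdot>\<^sub>v ls ! i) $ c)"
    using c unfolding vec_sum_def weighted_cols_def
    by (simp add: sum.reindex[OF inj_on_weighted_cols])
  also have "\<dots> = (\<Sum>i | i < length ls \<and> w $ i \<noteq> 0. w $ i * ls ! i $ c)"
    using c d by (intro sum.cong) auto
  also have "\<dots> = (\<Sum>i = 0..<length ls. w $ i * ls ! i $ c)"
    by (intro sum.mono_neutral_left) auto
  also have "\<dots> = (mat_of_cols p ls *\<^sub>v w) $ c"
    using c assms by (auto simp: scalar_prod_def mat_of_cols_index mult.commute intro!: sum.cong)
  finally show "vec_sum p (weighted_cols ls w) $ c = (mat_of_cols p ls *\<^sub>v w) $ c" .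
qed (simp add: vec_sum_def)

lemma weighted_cols_nonparallel: "weighted_cols ls w \<in> nonparallel_sets p"
proof -
  have n: "ls ! i \<in> normalized_vecs p" if "i < length ls" for i
    using that ls nth_mem by blast
  have z: "w $ i \<cdot>\<^sub>v ls ! i \<noteq> 0\<^sub>v p" if "i < length ls" "w $ i \<noteq> 0" for i
  proof
    assume "w $ i \<cdot>\<^sub>v ls ! i = 0\<^sub>v p"
    then have "w $ i \<cdot>\<^sub>v ls ! i = 0 \<cdot>\<^sub>v ls ! i"
      using normalized_vecs_props(1)[OF n[OF that(1)]] by auto
    then show False using weighted_cols_eqD(2)[OF that(1,1,2)] that(2) by blast
  qed
  show ?thesis
    unfolding nonparallel_sets_def weighted_cols_def
  proof (clarsimp, intro conjI subsetI)
    fix x assume "x \<in> (\<lambda>i. w $ i \<cdot>\<^sub>v ls ! i) ` {i. i < length ls \<and> w $ i \<noteq> 0}"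
    then show "x \<in> carrier_vec p - {0\<^sub>v p}"
      using n normalized_vecs_props(1) z by auto
  next
    show "\<forall>i. i < length ls \<and> w $ i \<noteq> 0 \<longrightarrow> (\<forall>j. j < length ls \<and> w $ j \<noteq> 0 \<longrightarrow>
        (\<forall>a. w $ j \<cdot>\<^sub>v ls ! j = a \<cdot>\<^sub>v (w $ i \<cdot>\<^sub>v ls ! i) \<longrightarrow> w $ i \<cdot>\<^sub>v ls ! i = a \<cdot>\<^sub>v (w $ i \<cdot>\<^sub>v ls ! i)))"
    proof (intro allI impI, elim conjE)
      fix i j a
      assume h: "i < length ls" "w $ i \<noteq> 0" "j < length ls" "w $ j \<noteq> 0"
        and e: "w $ j \<cdot>\<^sub>v ls ! j = a \<cdot>\<^sub>v (w $ i \<cdot>\<^sub>v ls ! i)"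
      then have "w $ j \<cdot>\<^sub>v ls ! j = (a * w $ i) \<cdot>\<^sub>v ls ! i"
        by (simp add: smult_smult_assoc)
      then have "j = i" using weighted_cols_eqD(1)[OF h(3,1,4)] by blast
      then show "w $ i \<cdot>\<^sub>v ls ! i = a \<cdot>\<^sub>v (w $ i \<cdot>\<^sub>v ls ! i)" using e by simp
    qed
  qed
qed

lemma inj_on_weighted_cols_carrier: "inj_on (weighted_cols ls) (carrier_vec (length ls))"
proof (rule inj_onI)
  fix v w :: "'a vec"
  assume v: "v \<in> carrier_vec (length ls)" and w: "w \<in> carrier_vec (length ls)"
    and eq: "weighted_cols ls v = weighted_cols ls w"
  have sub: "x $ i = y $ i"
    if "weighted_cols ls x = weighted_cols ls y" "i < length ls" "x $ i \<noteq> 0" for x y :: "'a vec" and i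
  proof -
    have "x $ i \<cdot>\<^sub>v ls ! i \<in> weighted_cols ls y"
      using that by (auto simp: weighted_cols_def)
    then obtain j where "j < length ls" "x $ i \<cdot>\<^sub>v ls ! i = y $ j \<cdot>\<^sub>v ls ! j"
      by (auto simp: weighted_cols_def)
    then show ?thesis using weighted_cols_eqD[OF that(2) _ that(3)] by blast
  qed
  show "v = w"
  proof (rule eq_vecI)
    fix i assume "i < dim_vec w"
    then have i: "i < length ls" using w by simp
    show "v $ i = w $ i"
      using sub[OF eq i] sub[OF eq[symmetric] i] by metis
  qed (use v w in simp)
qed

text \<open>
  The coordinate at a point is the scalar that produces a member of the set; there is at most one
  such scalar, since two members on one line would be proportional.
\<close>

lemma weighted_cols_onto:
  assumes S: "S \<in> nonparallel_sets p"
  obtains w where "w \<in> carrier_vec (length ls)" "weighted_cols ls w = S"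
proof -
  define w where "w = vec (length ls)
    (\<lambda>i. if \<exists>a. a \<noteq> 0 \<and> a \<cdot>\<^sub>v ls ! i \<in> S then SOME a. a \<noteq> 0 \<and> a \<cdot>\<^sub>v ls ! i \<in> S else 0)"
  have w_in: "w $ i \<cdot>\<^sub>v ls ! i \<in> S" if "i < length ls" "w $ i \<noteq> 0" for i
  proof -
    from that have ex: "\<exists>a. a \<noteq> 0 \<and> a \<cdot>\<^sub>v ls ! i \<in> S" by (auto simp: w_def split: if_splits)
    then show ?thesis using that(1) someI_ex[OF ex] by (simp add: w_def)
  qed
  have w_nz: "w $ i \<noteq> 0" if "i < length ls" "a \<noteq> 0" "a \<cdot>\<^sub>v ls ! i \<in> S" for i a
  proof -
    from that have ex: "\<exists>a. a \<noteq> 0 \<and> a \<cdot>\<^sub>v ls ! i \<in> S" by blast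
    then show ?thesis using that(1) someI_ex[OF ex] by (simp add: w_def)
  qed
  have "weighted_cols ls w = S"
  proof (intro equalityI subsetI)
    fix x assume "x \<in> weighted_cols ls w"
    then show "x \<in> S" using w_in by (auto simp: weighted_cols_def)
  next
    fix x assume x: "x \<in> S"
    then have "x \<in> carrier_vec p" "x \<noteq> 0\<^sub>v p" using S by (auto simp: nonparallel_sets_def)
    then obtain a l where al: "a \<noteq> 0" "l \<in> normalized_vecs p" "x = a \<cdot>\<^sub>v l"
      by (rule normalized_vecs_representative)
    then obtain i where i: "i < length ls" "l = ls ! i"
      using ls by (metis in_set_conv_nth)
    have nz: "w $ i \<noteq> 0" using w_nz[OF i(1) al(1)] x al i by simp
    have "x = (a / w $ i) \<cdot>\<^sub>v (w $ i \<cdot>\<^sub>v ls ! i)"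
      using nz al i by (simp add: smult_smult_assoc)
    then have "w $ i \<cdot>\<^sub>v ls ! i = x"
      using S x w_in[OF i(1) nz] unfolding nonparallel_sets_def by blast
    then show "x \<in> weighted_cols ls w"
      using i nz by (auto simp: weighted_cols_def)
  qed
  moreover have "w \<in> carrier_vec (length ls)" by (simp add: w_def)
  ultimately show ?thesis using that by blast
qed

lemma coset_weight_count:
  "card {w \<in> carrier_vec (length ls). mat_of_cols p ls *\<^sub>v w = v \<and> hamming_wt w = j}
     = nonparallel_count TYPE('a) p j v"
  unfolding nonparallel_count_def
proof (rule bij_betw_same_card[of "weighted_cols ls"], unfold bij_betw_def, intro conjI)
  show "inj_on (weighted_cols ls)
     {w \<in> carrier_vec (length ls). mat_of_cols p ls *\<^sub>v w = v \<and> hamming_wt w = j}"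
    using inj_on_weighted_cols_carrier by (rule inj_on_subset) auto
  show "weighted_cols ls ` {w \<in> carrier_vec (length ls). mat_of_cols p ls *\<^sub>v w = v \<and> hamming_wt w = j}
     = {S \<in> nonparallel_sets p. card S = j \<and> vec_sum p S = v}"
  proof (intro equalityI subsetI)
    fix S assume "S \<in> {S \<in> nonparallel_sets p. card S = j \<and> vec_sum p S = v}"
    then show "S \<in> weighted_cols ls `
        {w \<in> carrier_vec (length ls). mat_of_cols p ls *\<^sub>v w = v \<and> hamming_wt w = j}"
      using weighted_cols_onto[of S] card_weighted_cols vec_sum_weighted_cols
      by (smt (verit) imageI mem_Collect_eq)
  qed (auto simp: weighted_cols_nonparallel card_weighted_cols vec_sum_weighted_cols)
qed

end

text \<open>
  Two hyperplanes of functionals do not cover the dual space. A coordinate functional serves if both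
  vectors are nonzero there; otherwise the sum of two coordinates does.
\<close>

lemma nonvanishing_functional:
  fixes u v :: "'a::{field,finite} vec"
  assumes "u \<in> carrier_vec p" "u \<noteq> 0\<^sub>v p" "v \<in> carrier_vec p" "v \<noteq> 0\<^sub>v p"
  obtains c where "c \<in> carrier_vec p" "c \<bullet> u = 1" "c \<bullet> v \<noteq> 0"
proof -
  have nz: "\<exists>i<p. x $ i \<noteq> 0" if "x \<in> carrier_vec p" "x \<noteq> 0\<^sub>v p" for x :: "'a vec"
    using that by (metis carrier_vecD eq_vecI index_zero_vec)
  obtain i where i: "i < p" "u $ i \<noteq> 0" using nz assms by blast
  obtain k where k: "k < p" "v $ k \<noteq> 0" using nz assms by blast
  let ?e = "\<lambda>i. unit_vec p i :: 'a vec"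
  have "\<exists>d \<in> carrier_vec p. d \<bullet> u \<noteq> 0 \<and> d \<bullet> v \<noteq> 0"
  proof -
    consider "v $ i \<noteq> 0" | "u $ k \<noteq> 0" | "v $ i = 0" "u $ k = 0" by blast
    then show ?thesis
    proof cases
      case 1 then show ?thesis using i assms by (intro bexI[of _ "?e i"]) auto
    next
      case 2 then show ?thesis using k assms by (intro bexI[of _ "?e k"]) auto
    next
      case 3 then show ?thesis using i k assms
        by (intro bexI[of _ "?e i + ?e k"]) (auto simp: add_scalar_prod_distrib[of _ p])
    qed
  qed
  then obtain d where d: "d \<in> carrier_vec p" "d \<bullet> u \<noteq> 0" "d \<bullet> v \<noteq> 0" by blast
  show ?thesis
    by (rule that[of "(1 / (d \<bullet> u)) \<cdot>\<^sub>v d"]) (use d assms in auto)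
qed

text \<open>
  The map $x \<mapsto> x + (c \<cdot> x)(v - u)$ with $c \<cdot> u = 1$ sends $u$ to $v$, and $c \<cdot> v \<noteq> 0$ makes it injective:
  it multiplies $c \<cdot> x$ by $c \<cdot> v$, so its value determines $c \<cdot> x$ and then $x$. Being linear, it
  carries nonparallel sets of size $j$ with sum $u$ injectively to those with sum $v$.
\<close>

lemma nonparallel_count_le:
  fixes u v :: "'a::{field,finite} vec"
  assumes u: "u \<in> carrier_vec p" "u \<noteq> 0\<^sub>v p" and v: "v \<in> carrier_vec p" "v \<noteq> 0\<^sub>v p"
  shows "nonparallel_count TYPE('a) p j u \<le> nonparallel_count TYPE('a) p j v"
proof -
  obtain c where c: "c \<in> carrier_vec p" "c \<bullet> u = 1" "c \<bullet> v \<noteq> 0"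
    using nonvanishing_functional[OF assms] .
  define g where "g x = x + (c \<bullet> x) \<cdot>\<^sub>v (v - u)" for x
  have g_carrier: "g x \<in> carrier_vec p" if "x \<in> carrier_vec p" for x
    using that u v by (simp add: g_def)
  have g_u: "g u = v" unfolding g_def c using u v by (intro eq_vecI) auto
  have c_g: "c \<bullet> g x = (c \<bullet> x) * (c \<bullet> v)" if "x \<in> carrier_vec p" for x
    using that c u v
    by (simp add: g_def scalar_prod_add_distrib[of _ p] scalar_prod_minus_distrib[of _ p] algebra_simps)
  have g_smult: "g (a \<cdot>\<^sub>v x) = a \<cdot>\<^sub>v g x" if "x \<in> carrier_vec p" for a x
    using that c u v unfolding g_def
    by (intro eq_vecI) (auto simp: algebra_simps)
  have g_inj: "inj_on g (carrier_vec p)"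
  proof (rule inj_onI)
    fix x y assume xy: "x \<in> carrier_vec p" "y \<in> carrier_vec p" "g x = g y"
    then have "(c \<bullet> x) * (c \<bullet> v) = (c \<bullet> y) * (c \<bullet> v)" using c_g by metis
    then have "c \<bullet> x = c \<bullet> y" using c by simp
    show "x = y"
    proof (rule eq_vecI)
      fix i assume "i < dim_vec y"
      moreover have "g x $ i = g y $ i" using xy by simp
      ultimately show "x $ i = y $ i" using xy u v \<open>c \<bullet> x = c \<bullet> y\<close> by (simp add: g_def)
    qed (use xy in auto)
  qed
  have g_nz: "g x \<noteq> 0\<^sub>v p" if "x \<in> carrier_vec p" "x \<noteq> 0\<^sub>v p" for x
  proof
    assume "g x = 0\<^sub>v p"
    also have "0\<^sub>v p = g (0\<^sub>v p)" using c u v by (intro eq_vecI) (auto simp: g_def)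
    finally show False using that inj_onD[OF g_inj] by force
  qed
  have g_sum: "vec_sum p (g ` S) = g (vec_sum p S)" if S: "S \<in> nonparallel_sets p" for S
  proof (rule eq_vecI)
    fix r assume "r < dim_vec (g (vec_sum p S))"
    then have r: "r < p" using u v by (simp add: g_def vec_sum_def)
    have SC: "S \<subseteq> carrier_vec p" using S by (auto simp: nonparallel_sets_def)
    have "vec_sum p (g ` S) $ r = (\<Sum>x\<in>S. g x $ r)"
      using r by (simp add: vec_sum_def sum.reindex[OF inj_on_subset[OF g_inj SC]])
    also have "\<dots> = (\<Sum>x\<in>S. x $ r + (c \<bullet> x) * (v $ r - u $ r))"
      using SC r u v by (intro sum.cong) (auto simp: g_def)
    also have "\<dots> = (\<Sum>x\<in>S. x $ r) + (\<Sum>x\<in>S. c \<bullet> x) * (v $ r - u $ r)"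
      by (simp add: sum.distrib sum_distrib_right)
    also have "(\<Sum>x\<in>S. c \<bullet> x) = (\<Sum>x\<in>S. \<Sum>i = 0..<p. c $ i * x $ i)"
      using SC by (intro sum.cong) (auto simp: scalar_prod_def)
    also have "\<dots> = c \<bullet> vec_sum p S"
      by (subst sum.swap) (simp add: scalar_prod_def vec_sum_def sum_distrib_left)
    finally show "vec_sum p (g ` S) $ r = g (vec_sum p S) $ r"
      using r u v by (simp add: g_def vec_sum_def)
  qed (use u v in \<open>simp add: g_def vec_sum_def\<close>)
  have g_nonparallel: "g ` S \<in> nonparallel_sets p" if S: "S \<in> nonparallel_sets p" for S
  proof -
    have SC: "x \<in> carrier_vec p" "x \<noteq> 0\<^sub>v p" if "x \<in> S" for x
      using S that by (auto simp: nonparallel_sets_def)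
    have "g x = g y" if "x \<in> S" "y \<in> S" "g y = a \<cdot>\<^sub>v g x" for x y a
    proof -
      have "g y = g (a \<cdot>\<^sub>v x)" using that SC g_smult by simp
      then have "y = a \<cdot>\<^sub>v x" using inj_onD[OF g_inj] that SC by simp
      then have "x = y" using S that(1,2) unfolding nonparallel_sets_def by blast
      then show ?thesis by simp
    qed
    then have "\<forall>x\<in>g ` S. \<forall>y\<in>g ` S. \<forall>a. y = a \<cdot>\<^sub>v x \<longrightarrow> x = y"
      by (intro ballI allI impI) (elim imageE, metis)
    moreover have "g ` S \<subseteq> carrier_vec p - {0\<^sub>v p}"
    proof (rule image_subsetI)
      fix x assume "x \<in> S"
      then show "g x \<in> carrier_vec p - {0\<^sub>v p}" using SC g_carrier g_nz by simp
    qed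
    ultimately show ?thesis unfolding nonparallel_sets_def by (intro CollectI conjI)
  qed
  show ?thesis
    unfolding nonparallel_count_def
  proof (rule card_inj_on_le[of "(`) g"])
    show "inj_on ((`) g) {S \<in> nonparallel_sets p. card S = j \<and> vec_sum p S = u}"
      using inj_on_image_Pow[OF g_inj] by (rule inj_on_subset) (use nonparallel_sets_carrier in blast)
    show "(`) g ` {S \<in> nonparallel_sets p. card S = j \<and> vec_sum p S = u}
        \<subseteq> {S \<in> nonparallel_sets p. card S = j \<and> vec_sum p S = v}"
    proof clarify
      fix S assume S: "S \<in> nonparallel_sets p" "u = vec_sum p S" "j = card S"
      then have "inj_on g S"
        by (intro inj_on_subset[OF g_inj]) (use S(1) nonparallel_sets_carrier in blast)
      then show "g ` S \<in> nonparallel_sets p \<and> card (g ` S) = card S \<and> vec_sum p (g ` S) = v"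
        using g_nonparallel[OF S(1)] g_sum[OF S(1)] g_u S(2) by (simp add: card_image)
    qed
    show "finite {S \<in> nonparallel_sets p. card S = j \<and> vec_sum p S = v}"
      by (rule finite_subset[OF Collect_restrict finite_nonparallel_sets])
  qed
qed

text \<open>
  All nontrivial cosets of the Hamming code share one weight distribution. This is why the part of a
  word on the treatment columns matters only through its length and through whether it is a defining
  word, a word confounded with blocks, or neither.
\<close>

lemma nonparallel_count_nonzero_eq:
  fixes u v :: "'a::{field,finite} vec"
  assumes "u \<in> carrier_vec p - {0\<^sub>v p}" "v \<in> carrier_vec p - {0\<^sub>v p}"
  shows "nonparallel_count TYPE('a) p j u = nonparallel_count TYPE('a) p j v"
  using assms by (intro antisym nonparallel_count_le) auto

text \<open>
  The values at $j = 0, 1$ give the identity its triangular shape: a treatment word of length $i$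
  first contributes to the unblocked pattern at length $i$ if it is a defining word, and at length
  $i + 1$ if it is confounded with blocks.
\<close>

lemma nonparallel_count_0:
  fixes v :: "'a::{field,finite} vec"
  shows "nonparallel_count TYPE('a) p 0 v = (if v = 0\<^sub>v p then 1 else 0)"
proof -
  have "{S \<in> nonparallel_sets p. card S = 0 \<and> vec_sum p S = v} = (if v = 0\<^sub>v p then {{}} else {})"
  proof (intro equalityI subsetI)
    fix S assume "S \<in> {S \<in> nonparallel_sets p. card S = 0 \<and> vec_sum p S = v}"
    then have "S = {}" "vec_sum p S = v" using finite_nonparallel_set[of S p] by auto
    moreover have "vec_sum p {} = (0\<^sub>v p :: 'a vec)" by (intro eq_vecI) (auto simp: vec_sum_def)
    ultimately show "S \<in> (if v = 0\<^sub>v p then {{}} else {})" by simp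
  next
    fix S assume "S \<in> (if v = 0\<^sub>v p then {{} :: 'a vec set} else {})"
    then have "S = {}" "v = 0\<^sub>v p" by (auto split: if_splits)
    moreover have "vec_sum p {} = (0\<^sub>v p :: 'a vec)" by (intro eq_vecI) (auto simp: vec_sum_def)
    ultimately show "S \<in> {S \<in> nonparallel_sets p. card S = 0 \<and> vec_sum p S = v}"
      by (simp add: nonparallel_sets_def)
  qed
  then show ?thesis by (simp add: nonparallel_count_def)
qed

lemma nonparallel_count_1:
  fixes v :: "'a::{field,finite} vec"
  assumes "v \<in> carrier_vec p"
  shows "nonparallel_count TYPE('a) p (Suc 0) v = (if v = 0\<^sub>v p then 0 else 1)"
proof -
  have s: "vec_sum p {x} = x" if "x \<in> carrier_vec p" for x :: "'a vec"
    using that by (intro eq_vecI) (auto simp: vec_sum_def)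
  have "{S \<in> nonparallel_sets p. card S = Suc 0 \<and> vec_sum p S = v} = (if v = 0\<^sub>v p then {} else {{v}})"
  proof (intro equalityI subsetI)
    fix S assume "S \<in> {S \<in> nonparallel_sets p. card S = Suc 0 \<and> vec_sum p S = v}"
    then obtain x where "S = {x}" "{x} \<in> nonparallel_sets p" "vec_sum p {x} = v"
      by (auto simp: card_Suc_eq)
    then show "S \<in> (if v = 0\<^sub>v p then {} else {{v}})"
      using s[of x] unfolding nonparallel_sets_def by auto
  next
    fix S assume "S \<in> (if v = 0\<^sub>v p then {} else {{v}})"
    then have "S = {v}" "v \<noteq> 0\<^sub>v p" by (auto split: if_splits)
    then show "S \<in> {S \<in> nonparallel_sets p. card S = Suc 0 \<and> vec_sum p S = v}"
      using assms s[of v] by (simp add: nonparallel_sets_def)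
  qed
  then show ?thesis by (simp add: nonparallel_count_def)
qed

section \<open>Lexicographic comparison of wordlength patterns\<close>

lemma lex_leI:
  assumes "\<And>j. (\<And>i. i < j \<Longrightarrow> f i = g i) \<Longrightarrow> f j \<le> g j"
  shows "lex_le f g"
proof (cases "f = g")
  case False
  then obtain j where j: "f j \<noteq> g j" and min: "\<forall>i<j. \<not> f i \<noteq> g i"
    using exists_least_iff[of "\<lambda>i. f i \<noteq> g i"] by blast
  then have "f j < g j" using assms[of j] by force
  then show ?thesis using min by (auto simp: lex_le_def less_fun_def)
qed (simp add: lex_le_def)

lemma lex_leD:
  assumes "lex_le f g" "\<And>i. i < j \<Longrightarrow> f i = g i"
  shows "f j \<le> g j"
proof (cases "f = g")
  case False
  then obtain k where k: "f k < g k" "\<And>i. i < k \<Longrightarrow> f i = g i"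
    using assms(1) by (auto simp: lex_le_def less_fun_def)
  show ?thesis
    using k assms(2)[of k] by (cases j k rule: linorder_cases) auto
qed simp

text \<open>
  The index arithmetic behind the positions of the four sequences.
\<close>

lemma div_mod_2_3:
  fixes t :: nat
  shows "2 * t div 2 = t" "2 * t mod 2 = 0" "(2 * t + 1) div 2 = t" "(2 * t + 1) mod 2 = 1"
    "3 * t div 3 = t" "3 * t mod 3 = 0" "(3 * t + 1) div 3 = t" "(3 * t + 1) mod 3 = 1"
    "(3 * t + 2) div 3 = t" "(3 * t + 2) mod 3 = 2"
    "t + 2 + 1 = t + 3" "2 * (t + 2) - 1 = 2 * t + 3" "2 * (t + 2) = 2 * t + 4" "2 * t + 4 - 1 = 2 * t + 3"
  by presburger+

lemma W_scf_nth:
  "W_scf T F (2 * t) = A0 T (t + 3)"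
  "W_scf T F (2 * t + 1) = A1 T F (t + 2)"
  unfolding W_scf_def Let_def div_mod_2_3 by simp_all

lemma W_1_nth:
  "W_1 T F (3 * t) = A0 T (2 * t + 3)"
  "W_1 T F (3 * t + 1) = A0 T (2 * t + 4)"
  "W_1 T F (3 * t + 2) = A1 T F (t + 2)"
  unfolding W_1_def Let_def div_mod_2_3 by simp_all

lemma W_2_nth:
  "W_2 T F (3 * t) = A0 T (2 * t + 3)"
  "W_2 T F (3 * t + 1) = A1 T F (t + 2)"
  "W_2 T F (3 * t + 2) = A0 T (2 * t + 4)"
  unfolding W_2_def Let_def div_mod_2_3 by simp_all

lemma W_cc_nth:
  "W_cc T F (2 * t) = real ((2 * t + 3) choose (t + 2)) * A0 T (2 * t + 3) + A1 T F (t + 2)"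
  "W_cc T F (2 * t + 1) = A0 T (2 * t + 4)"
  unfolding W_cc_def Let_def div_mod_2_3 by simp_all

lemma central_choose_gt_1: "1 < (2 * t + 3) choose (t + 2)"
proof -
  have "(2 * t + 3) choose (t + 2) = (2 * t + 2 choose (t + 1)) + (2 * t + 2 choose (t + 2))"
    using binomial_Suc_Suc[of "2 * t + 2" "t + 1"] by (simp add: numeral_eq_Suc)
  moreover have "0 < (2 * t + 2 choose (t + 1))" "0 < (2 * t + 2 choose (t + 2))"
    by (intro zero_less_binomial, simp)+
  ultimately show ?thesis by linarith
qed

lemma index_from_3_cases:
  fixes i :: nat
  obtains "i \<le> 2" | t where "i = 2 * t + 3" | t where "i = 2 * t + 4"
proof -
  have "i \<le> 2 \<or> (\<exists>t. i = 2 * t + 3) \<or> (\<exists>t. i = 2 * t + 4)" by presburger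
  then show ?thesis using that by blast
qed

text \<open>
  All four criteria follow from the same two minimality properties. The first comes from $D_T$, the
  second from $D_{un}$: once the defining words up to length $m$ and the confounded words below length
  $m$ agree, the next entry of the unblocked pattern compares $A_{m+1,0} + A_{m,1}$.
\<close>

context
  fixes T F T' F' :: "'a::{field,finite} mat"
  assumes A0_small: "\<And>i. i \<le> 2 \<Longrightarrow> A0 T i = A0 T' i"
    and A1_small: "\<And>i. i \<le> 1 \<Longrightarrow> A1 T F i = A1 T' F' i"
    and A0_min: "\<And>m. (\<And>i. i < m \<Longrightarrow> A0 T i = A0 T' i) \<Longrightarrow> A0 T m \<le> A0 T' m"
    and sum_min: "\<And>m. (\<And>i. i \<le> m \<Longrightarrow> A0 T i = A0 T' i) \<Longrightarrow>
       (\<And>i. i < m \<Longrightarrow> A1 T F i = A1 T' F' i) \<Longrightarrow>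
       A0 T (Suc m) + A1 T F m \<le> A0 T' (Suc m) + A1 T' F' m"
begin

text \<open>
  In $W_{scf}$, $W_1$ and $W_2$ the entry $A_{m+1,0}$ comes before $A_{m,1}$, so it already agrees when
  $A_{m,1}$ is compared; the same holds in $W_{cc}$ for $m \<ge> 3$.
\<close>

lemma A1_min:
  assumes "\<And>i. i \<le> Suc m \<Longrightarrow> A0 T i = A0 T' i" "\<And>i. i < m \<Longrightarrow> A1 T F i = A1 T' F' i"
  shows "A1 T F m \<le> A1 T' F' m"
proof -
  have "A0 T (Suc m) + A1 T F m \<le> A0 T' (Suc m) + A1 T' F' m"
    by (rule sum_min) (use assms in simp_all)
  then show ?thesis using assms(1)[of "Suc m"] by simp
qed

lemma lex_le_W_scf: "lex_le (W_scf T F) (W_scf T' F')"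
proof (rule lex_leI)
  fix j assume eq: "W_scf T F i = W_scf T' F' i" if "i < j" for i
  \<comment> \<open>$A_{i,0}$ has position $2(i - 3)$ and $A_{i,1}$ has position $2(i - 2) + 1$.\<close>
  have a: "A0 T i = A0 T' i" if "2 * i < j + 6" for i
  proof (cases "i \<le> 2")
    case False
    then obtain t where "i = t + 3" by (metis add.commute le_Suc_ex not_less_eq_eq numeral_3_eq_3 numeral_2_eq_2)
    then show ?thesis using eq[of "2 * t"] that by (simp only: W_scf_nth) simp
  qed (simp add: A0_small)
  have b: "A1 T F i = A1 T' F' i" if "2 * i < j + 3" for i
  proof (cases "i \<le> 1")
    case False
    then obtain t where "i = t + 2" by (metis add.commute le_Suc_ex not_less_eq_eq numeral_2_eq_2 One_nat_def)
    then show ?thesis using eq[of "2 * t + 1"] that by (simp only: W_scf_nth) simp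
  qed (simp add: A1_small)
  have "(\<exists>t. j = 2 * t) \<or> (\<exists>t. j = 2 * t + 1)" by presburger
  then show "W_scf T F j \<le> W_scf T' F' j"
  proof (elim disjE exE)
    fix t assume j: "j = 2 * t"
    show ?thesis unfolding j W_scf_nth by (rule A0_min) (use j a in simp)
  next
    fix t assume j: "j = 2 * t + 1"
    show ?thesis unfolding j W_scf_nth by (rule A1_min) (use j a b in simp_all)
  qed
qed

lemma lex_le_W_1: "lex_le (W_1 T F) (W_1 T' F')"
proof (rule lex_leI)
  fix j assume eq: "W_1 T F i = W_1 T' F' i" if "i < j" for i
  have a: "A0 T i = A0 T' i" if "\<And>t. i = 2 * t + 3 \<Longrightarrow> 3 * t < j" "\<And>t. i = 2 * t + 4 \<Longrightarrow> 3 * t + 1 < j" for i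
  proof (cases i rule: index_from_3_cases)
    case (2 t)
    then show ?thesis using eq[of "3 * t"] that(1) by (simp only: W_1_nth)
  next
    case (3 t)
    then show ?thesis using eq[of "3 * t + 1"] that(2) by (simp only: W_1_nth)
  qed (simp add: A0_small)
  \<comment> \<open>$A_{i,1}$ has position $3(i - 2) + 2$.\<close>
  have b: "A1 T F i = A1 T' F' i" if "3 * i < j + 4" for i
  proof (cases "i \<le> 1")
    case False
    then obtain t where "i = t + 2" by (metis add.commute le_Suc_ex not_less_eq_eq numeral_2_eq_2 One_nat_def)
    then show ?thesis using eq[of "3 * t + 2"] that by (simp only: W_1_nth) simp
  qed (simp add: A1_small)
  have "(\<exists>t. j = 3 * t) \<or> (\<exists>t. j = 3 * t + 1) \<or> (\<exists>t. j = 3 * t + 2)" by presburger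
  then show "W_1 T F j \<le> W_1 T' F' j"
  proof (elim disjE exE)
    fix t assume j: "j = 3 * t"
    show ?thesis unfolding j W_1_nth by (rule A0_min, rule a) (use j in simp_all)
  next
    fix t assume j: "j = 3 * t + 1"
    show ?thesis unfolding j W_1_nth by (rule A0_min, rule a) (use j in simp_all)
  next
    fix t assume j: "j = 3 * t + 2"
    show ?thesis unfolding j W_1_nth by (rule A1_min, rule a) (use j b in simp_all)
  qed
qed

lemma lex_le_W_2: "lex_le (W_2 T F) (W_2 T' F')"
proof (rule lex_leI)
  fix j assume eq: "W_2 T F i = W_2 T' F' i" if "i < j" for i
  have a: "A0 T i = A0 T' i" if "\<And>t. i = 2 * t + 3 \<Longrightarrow> 3 * t < j" "\<And>t. i = 2 * t + 4 \<Longrightarrow> 3 * t + 2 < j" for i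
  proof (cases i rule: index_from_3_cases)
    case (2 t)
    then show ?thesis using eq[of "3 * t"] that(1) by (simp only: W_2_nth)
  next
    case (3 t)
    then show ?thesis using eq[of "3 * t + 2"] that(2) by (simp only: W_2_nth)
  qed (simp add: A0_small)
  \<comment> \<open>$A_{i,1}$ has position $3(i - 2) + 1$.\<close>
  have b: "A1 T F i = A1 T' F' i" if "3 * i < j + 5" for i
  proof (cases "i \<le> 1")
    case False
    then obtain t where "i = t + 2" by (metis add.commute le_Suc_ex not_less_eq_eq numeral_2_eq_2 One_nat_def)
    then show ?thesis using eq[of "3 * t + 1"] that by (simp only: W_2_nth) simp
  qed (simp add: A1_small)
  have "(\<exists>t. j = 3 * t) \<or> (\<exists>t. j = 3 * t + 1) \<or> (\<exists>t. j = 3 * t + 2)" by presburger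
  then show "W_2 T F j \<le> W_2 T' F' j"
  proof (elim disjE exE)
    fix t assume j: "j = 3 * t"
    show ?thesis unfolding j W_2_nth by (rule A0_min, rule a) (use j in simp_all)
  next
    fix t assume j: "j = 3 * t + 1"
    show ?thesis unfolding j W_2_nth by (rule A1_min, rule a) (use j b in simp_all)
  next
    fix t assume j: "j = 3 * t + 2"
    show ?thesis unfolding j W_2_nth by (rule A0_min, rule a) (use j in simp_all)
  qed
qed

text \<open>
  The first entry of a pair of $W_{cc}$ mixes two numbers, so equality of the entries must be shown to
  force equality of both. Writing it as $(c - 1) A_{2i-1,0} + (A_{2i-1,0} + A_{i,1})$ with $c > 1$ does
  this: both parts are minimized separately. For $i \<ge> 3$ the second part is minimal because
  $i + 1 \<le> 2i - 2$ and so $A_{i,1}$ alone is; for $i = 2$ it is itself an entry of the unblocked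
  pattern up to agreeing terms. The pairs are numbered by $t = i - 2$.
\<close>

lemma W_cc_step:
  assumes a: "\<And>i. i \<le> 2 * t + 2 \<Longrightarrow> A0 T i = A0 T' i"
    and b: "\<And>i. i \<le> t + 1 \<Longrightarrow> A1 T F i = A1 T' F' i"
  shows "W_cc T F (2 * t) \<le> W_cc T' F' (2 * t)"
    and "W_cc T F (2 * t) = W_cc T' F' (2 * t) \<Longrightarrow>
      A0 T (2 * t + 3) = A0 T' (2 * t + 3) \<and> A1 T F (t + 2) = A1 T' F' (t + 2)"
proof -
  define c where "c = real ((2 * t + 3) choose (t + 2))"
  have c: "c > 1" using central_choose_gt_1[of t] by (simp add: c_def)
  have A0: "A0 T (2 * t + 3) \<le> A0 T' (2 * t + 3)"
    by (rule A0_min) (use a in simp)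
  have le: "A0 T (2 * t + 3) + A1 T F (t + 2) \<le> A0 T' (2 * t + 3) + A1 T' F' (t + 2)"
  proof (cases "t = 0")
    case True
    then show ?thesis using sum_min[of 2] a b by (simp add: numeral_eq_Suc)
  next
    case False
    then have "A1 T F (t + 2) \<le> A1 T' F' (t + 2)"
      by (intro A1_min) (use a b in simp_all)
    then show ?thesis using A0 by simp
  qed
  have split: "W_cc T F (2 * t) = (c - 1) * A0 T (2 * t + 3) + (A0 T (2 * t + 3) + A1 T F (t + 2))"
    "W_cc T' F' (2 * t) = (c - 1) * A0 T' (2 * t + 3) + (A0 T' (2 * t + 3) + A1 T' F' (t + 2))"
    unfolding W_cc_nth c_def[symmetric] by (simp_all add: algebra_simps)
  have le': "(c - 1) * A0 T (2 * t + 3) \<le> (c - 1) * A0 T' (2 * t + 3)"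
    using A0 c by simp
  show "W_cc T F (2 * t) \<le> W_cc T' F' (2 * t)"
    unfolding split using le le' by linarith
  assume "W_cc T F (2 * t) = W_cc T' F' (2 * t)"
  then have "(c - 1) * A0 T (2 * t + 3) = (c - 1) * A0 T' (2 * t + 3)"
    and "A0 T (2 * t + 3) + A1 T F (t + 2) = A0 T' (2 * t + 3) + A1 T' F' (t + 2)"
    unfolding split using le le' by linarith+
  then show "A0 T (2 * t + 3) = A0 T' (2 * t + 3) \<and> A1 T F (t + 2) = A1 T' F' (t + 2)"
    using c by simp
qed

lemma lex_le_W_cc: "lex_le (W_cc T F) (W_cc T' F')"
proof (rule lex_leI)
  fix j assume eq: "W_cc T F i = W_cc T' F' i" if "i < j" for i
  \<comment> \<open>The first $t$ pairs lie before position $j$; they agree only as combinations, so the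
    individual numbers are recovered pair by pair.\<close>
  have prefix: "(\<forall>i \<le> 2 * t + 2. A0 T i = A0 T' i) \<and> (\<forall>i \<le> t + 1. A1 T F i = A1 T' F' i)"
    if "2 * t \<le> j" for t
    using that
  proof (induction t)
    case 0
    then show ?case using A0_small A1_small by simp
  next
    case (Suc t)
    then have IH: "\<And>i. i \<le> 2 * t + 2 \<Longrightarrow> A0 T i = A0 T' i" "\<And>i. i \<le> t + 1 \<Longrightarrow> A1 T F i = A1 T' F' i"
      by simp_all
    have 1: "A0 T (2 * t + 3) = A0 T' (2 * t + 3) \<and> A1 T F (t + 2) = A1 T' F' (t + 2)"
      using W_cc_step(2)[of t] IH eq[of "2 * t"] Suc.prems by simp
    have 2: "A0 T (2 * t + 4) = A0 T' (2 * t + 4)"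
      using eq[of "2 * t + 1"] Suc.prems by (simp only: W_cc_nth) simp
    show ?case
    proof (intro conjI allI impI)
      fix i assume "i \<le> 2 * Suc t + 2"
      then consider "i \<le> 2 * t + 2" | "i = 2 * t + 3" | "i = 2 * t + 4" by fastforce
      then show "A0 T i = A0 T' i" using IH(1) 1 2 by cases auto
    next
      fix i assume "i \<le> Suc t + 1"
      then consider "i \<le> t + 1" | "i = t + 2" by linarith
      then show "A1 T F i = A1 T' F' i" using IH(2) 1 by cases auto
    qed
  qed
  have "(\<exists>t. j = 2 * t) \<or> (\<exists>t. j = 2 * t + 1)" by presburger
  then show "W_cc T F j \<le> W_cc T' F' j"
  proof (elim disjE exE)
    fix t assume j: "j = 2 * t"
    show ?thesis unfolding j by (rule W_cc_step(1)) (use j prefix[of t] in simp_all)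
  next
    fix t assume j: "j = 2 * t + 1"
    have p: "(\<forall>i \<le> 2 * t + 2. A0 T i = A0 T' i) \<and> (\<forall>i \<le> t + 1. A1 T F i = A1 T' F' i)"
      using prefix[of t] j by simp
    then have 1: "A0 T (2 * t + 3) = A0 T' (2 * t + 3)"
      using W_cc_step(2)[of t] eq[of "2 * t"] j by simp
    show ?thesis unfolding j W_cc_nth
    proof (rule A0_min)
      fix i assume "i < 2 * t + 4"
      then consider "i \<le> 2 * t + 2" | "i = 2 * t + 3" by linarith
      then show "A0 T i = A0 T' i" using p 1 by cases auto
    qed
  qed
qed

end

section \<open>Wordlength pattern of the unblocked design\<close>

text \<open>
  For $x = Bv$ this counts the treatment words whose syndrome is cancelled by the block effect $v$.
\<close>

definition coset_count :: "'a::{field,finite} mat \<Rightarrow> nat \<Rightarrow> 'a vec \<Rightarrow> nat" where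
  "coset_count T i x =
     card {w \<in> carrier_vec (dim_col T). T *\<^sub>v w + x = 0\<^sub>v (dim_row T) \<and> hamming_wt w = i}"

definition word_pairs :: "'a::{field,finite} mat \<Rightarrow> 'a mat \<Rightarrow> nat \<Rightarrow> nat \<Rightarrow> ('a vec \<times> 'a vec) set" where
  "word_pairs T F i j =
     {(w1, w2). w1 \<in> carrier_vec (dim_col T) \<and> w2 \<in> carrier_vec (dim_col F) \<and>
                T *\<^sub>v w1 + F *\<^sub>v w2 = 0\<^sub>v (dim_row T) \<and> hamming_wt w1 = i \<and> hamming_wt w2 = j}"

lemma finite_word_pairs: "finite (word_pairs T F i j)"
proof (rule finite_subset)
  show "word_pairs T F i j \<subseteq> carrier_vec (dim_col T) \<times> carrier_vec (dim_col F)"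
    unfolding word_pairs_def by blast
qed (simp add: finite_carrier_vec)

lemma hamming_wt_append: "hamming_wt (v @\<^sub>v w) = hamming_wt v + hamming_wt w"
proof -
  have "{i. i < dim_vec (v @\<^sub>v w) \<and> (v @\<^sub>v w) $ i \<noteq> 0}
      = {i. i < dim_vec v \<and> v $ i \<noteq> 0} \<union> (\<lambda>i. dim_vec v + i) ` {i. i < dim_vec w \<and> w $ i \<noteq> 0}"
  proof (intro equalityI subsetI)
    fix i assume i: "i \<in> {i. i < dim_vec (v @\<^sub>v w) \<and> (v @\<^sub>v w) $ i \<noteq> 0}"
    show "i \<in> {i. i < dim_vec v \<and> v $ i \<noteq> 0} \<union> (\<lambda>i. dim_vec v + i) ` {i. i < dim_vec w \<and> w $ i \<noteq> 0}"
    proof (cases "i < dim_vec v")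
      case False
      then show ?thesis using i by (intro UnI2 image_eqI[of _ _ "i - dim_vec v"]) auto
    qed (use i in auto)
  qed auto
  moreover have "card ({i. i < dim_vec v \<and> v $ i \<noteq> 0} \<union> (\<lambda>i. dim_vec v + i) ` {i. i < dim_vec w \<and> w $ i \<noteq> 0})
      = card {i. i < dim_vec v \<and> v $ i \<noteq> 0} + card ((\<lambda>i. dim_vec v + i) ` {i. i < dim_vec w \<and> w $ i \<noteq> 0})"
    by (rule card_Un_disjoint) auto
  ultimately show ?thesis
    by (simp add: hamming_wt_def card_image)
qed

lemma unblocked_gen_carrier:
  assumes "T \<in> carrier_mat m n" "F \<in> carrier_mat m l"
  shows "unblocked_gen T F \<in> carrier_mat m (n + l)"
  by (rule carrier_matI) (use assms in \<open>simp_all add: unblocked_gen_def\<close>)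

lemma unblocked_gen_mult_append:
  assumes "T \<in> carrier_mat m n" "F \<in> carrier_mat m l" "w1 \<in> carrier_vec n" "w2 \<in> carrier_vec l"
  shows "unblocked_gen T F *\<^sub>v (w1 @\<^sub>v w2) = T *\<^sub>v w1 + F *\<^sub>v w2"
proof (rule eq_vecI)
  fix r assume "r < dim_vec (T *\<^sub>v w1 + F *\<^sub>v w2)"
  then have r: "r < m" using assms by simp
  have "row (unblocked_gen T F) r = row T r @\<^sub>v row F r"
    using assms r by (intro eq_vecI) (auto simp: unblocked_gen_def mat_of_cols_index nth_append)
  then show "(unblocked_gen T F *\<^sub>v (w1 @\<^sub>v w2)) $ r = (T *\<^sub>v w1 + F *\<^sub>v w2) $ r"
    using assms r unblocked_gen_carrier[OF assms(1,2)]
    by (simp add: scalar_prod_append[of _ n _ l])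
qed (use assms in \<open>simp add: unblocked_gen_def\<close>)

lemma card_unblocked_words:
  fixes T F :: "'a::{field,finite} mat"
  assumes T: "T \<in> carrier_mat m n" and F: "F \<in> carrier_mat m l"
  shows "card {w \<in> carrier_vec (n + l). unblocked_gen T F *\<^sub>v w = 0\<^sub>v m \<and> hamming_wt w = d}
       = (\<Sum>j\<le>d. card (word_pairs T F (d - j) j))"
proof -
  let ?W = "{w \<in> carrier_vec (n + l). unblocked_gen T F *\<^sub>v w = 0\<^sub>v m \<and> hamming_wt w = d}"
  have "(\<Sum>j\<le>d. card (word_pairs T F (d - j) j)) = card (\<Union>j\<le>d. word_pairs T F (d - j) j)"
    by (intro card_UN_disjoint[symmetric]) (auto simp: finite_word_pairs, auto simp: word_pairs_def)
  also have "\<dots> = card ?W"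
  proof (rule bij_betw_same_card[of "\<lambda>(w1, w2). w1 @\<^sub>v w2"], unfold bij_betw_def, intro conjI)
    show "inj_on (\<lambda>(w1, w2). w1 @\<^sub>v w2) (\<Union>j\<le>d. word_pairs T F (d - j) j)"
      using T by (auto simp: inj_on_def word_pairs_def append_vec_eq[of _ n])
    show "(\<lambda>(w1, w2). w1 @\<^sub>v w2) ` (\<Union>j\<le>d. word_pairs T F (d - j) j) = ?W"
    proof (intro equalityI subsetI)
      fix w assume "w \<in> (\<lambda>(w1, w2). w1 @\<^sub>v w2) ` (\<Union>j\<le>d. word_pairs T F (d - j) j)"
      then show "w \<in> ?W"
        using T F by (auto simp: word_pairs_def unblocked_gen_mult_append[OF T F] hamming_wt_append)
    next
      fix w assume w: "w \<in> ?W"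
      define w1 w2 where "w1 = vec_first w n" and "w2 = vec_last w l"
      have eq: "w1 @\<^sub>v w2 = w" and c: "w1 \<in> carrier_vec n" "w2 \<in> carrier_vec l"
        using w by (auto simp: w1_def w2_def)
      have "hamming_wt w1 + hamming_wt w2 = d"
        using w eq hamming_wt_append[of w1 w2] by simp
      then have "(w1, w2) \<in> word_pairs T F (d - hamming_wt w2) (hamming_wt w2)" "hamming_wt w2 \<le> d"
        using w c eq T F unblocked_gen_mult_append[OF T F c] by (auto simp: word_pairs_def)
      then show "w \<in> (\<lambda>(w1, w2). w1 @\<^sub>v w2) ` (\<Union>j\<le>d. word_pairs T F (d - j) j)"
        using eq by force
    qed
  qed
  finally show ?thesis ..
qed

text \<open>
  Thus $F w'$ depends only on the syndrome of $w$; when the list consists of all points, the second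
  factor is the parity check matrix of the Hamming code.
\<close>

lemma block_effects_mult:
  assumes "F = mat_of_cols (dim_row B) (map (\<lambda>l. B *\<^sub>v l) ls)"
    and B: "B \<in> carrier_mat m p" and ls: "set ls \<subseteq> carrier_vec p" and w: "w \<in> carrier_vec (length ls)"
  shows "F *\<^sub>v w = B *\<^sub>v (mat_of_cols p ls *\<^sub>v w)"
proof -
  have "F = B * mat_of_cols p ls"
  proof (rule eq_matI)
    fix i j assume ij: "i < dim_row (B * mat_of_cols p ls)" "j < dim_col (B * mat_of_cols p ls)"
    then have "ls ! j \<in> carrier_vec p" using ls by auto
    then show "F $$ (i, j) = (B * mat_of_cols p ls) $$ (i, j)"
      using ij B assms(1) by (simp add: mat_of_cols_index)
  qed (use assms(1) B in auto)
  then show ?thesis using B w by (simp add: assoc_mult_mat_vec[of _ m p _ "length ls"])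
qed

text \<open>
  Sort the pairs by the syndrome $v$ of the second component with respect to the Hamming code; for a
  fixed $v$ the two components are independent.
\<close>

lemma card_word_pairs:
  fixes T B F :: "'a::{field,finite} mat"
  assumes T: "T \<in> carrier_mat m n" and B: "B \<in> carrier_mat m p" and F: "block_effects p B F"
  shows "card (word_pairs T F i j)
       = (\<Sum>v\<in>carrier_vec p. coset_count T i (B *\<^sub>v v) * nonparallel_count TYPE('a) p j v)"
proof -
  obtain ls where dist: "distinct ls" and ls: "set ls = normalized_vecs p"
    and F_eq: "F = mat_of_cols (dim_row B) (map (\<lambda>l. B *\<^sub>v l) ls)"
    using F unfolding block_effects_def by blast
  have lsc: "set ls \<subseteq> carrier_vec p" unfolding ls using normalized_vecs_props(1) by blast
  have dF: "dim_col F = length ls" using F_eq by simp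
  let ?X = "\<lambda>v. {w \<in> carrier_vec (dim_col T). T *\<^sub>v w + B *\<^sub>v v = 0\<^sub>v (dim_row T) \<and> hamming_wt w = i}"
  let ?Y = "\<lambda>v. {w \<in> carrier_vec (length ls). mat_of_cols p ls *\<^sub>v w = v \<and> hamming_wt w = j}"
  have fin: "finite (?X v)" "finite (?Y v)" for v
    by (rule finite_subset[OF Collect_restrict finite_carrier_vec])+
  have "word_pairs T F i j = (\<Union>v\<in>carrier_vec p. ?X v \<times> ?Y v)"
  proof (intro equalityI subsetI)
    fix z assume "z \<in> word_pairs T F i j"
    then obtain w1 w2 where z: "z = (w1, w2)" "w1 \<in> carrier_vec (dim_col T)" "w2 \<in> carrier_vec (length ls)"
      "T *\<^sub>v w1 + F *\<^sub>v w2 = 0\<^sub>v (dim_row T)" "hamming_wt w1 = i" "hamming_wt w2 = j"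
      unfolding word_pairs_def dF by blast
    then have "z \<in> ?X (mat_of_cols p ls *\<^sub>v w2) \<times> ?Y (mat_of_cols p ls *\<^sub>v w2)"
      using block_effects_mult[OF F_eq B lsc z(3)] by simp
    moreover have "mat_of_cols p ls *\<^sub>v w2 \<in> carrier_vec p"
      by (rule carrier_vecI) simp
    ultimately show "z \<in> (\<Union>v\<in>carrier_vec p. ?X v \<times> ?Y v)" by blast
  next
    fix z assume "z \<in> (\<Union>v\<in>carrier_vec p. ?X v \<times> ?Y v)"
    then obtain w1 w2 v where "z = (w1, w2)" "w1 \<in> ?X v" and w2: "w2 \<in> ?Y v" by blast
    then show "z \<in> word_pairs T F i j"
      using block_effects_mult[OF F_eq B lsc, of w2] unfolding word_pairs_def dF by simp
  qed
  then have "card (word_pairs T F i j) = (\<Sum>v\<in>carrier_vec p. card (?X v \<times> ?Y v))"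
    by (simp only:) (intro card_UN_disjoint, auto simp: finite_carrier_vec fin)
  also have "\<dots> = (\<Sum>v\<in>carrier_vec p. coset_count T i (B *\<^sub>v v) * nonparallel_count TYPE('a) p j v)"
    by (intro sum.cong refl) (simp add: card_cartesian_product coset_count_def coset_weight_count[OF dist ls])
  finally show ?thesis .
qed

lemma mult_zero_vec:
  fixes B :: "'a::{field,finite} mat"
  assumes "B \<in> carrier_mat m p"
  shows "B *\<^sub>v 0\<^sub>v p = 0\<^sub>v m"
  using assms by (intro eq_vecI) auto

lemma A0_eq_coset_count:
  fixes T :: "'a::{field,finite} mat"
  assumes "T \<in> carrier_mat m n"
  shows "A0 T i = real (coset_count T i (0\<^sub>v m)) / real (CARD('a) - 1)"
proof -
  have "T *\<^sub>v w + 0\<^sub>v m = T *\<^sub>v w" if "w \<in> carrier_vec n" for w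
    using mult_mat_vec_carrier[OF assms that] by simp
  then have "{w \<in> carrier_vec (dim_col T). T *\<^sub>v w = 0\<^sub>v (dim_row T) \<and> hamming_wt w = i}
      = {w \<in> carrier_vec (dim_col T). T *\<^sub>v w + 0\<^sub>v m = 0\<^sub>v (dim_row T) \<and> hamming_wt w = i}"
    using assms by auto
  then show ?thesis unfolding A0_def coset_count_def by simp
qed

context
  fixes m n p :: nat and T B F :: "'a::{field,finite} mat"
  assumes T: "T \<in> carrier_mat m n" and B: "B \<in> carrier_mat m p" and F: "block_effects p B F"
begin

lemma A1_eq_coset_count:
  "A1 T F i = (\<Sum>v\<in>carrier_vec p - {0\<^sub>v p}. real (coset_count T i (B *\<^sub>v v))) / real (CARD('a) - 1)"
proof -
  have "card (word_pairs T F i (Suc 0))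
      = (\<Sum>v\<in>carrier_vec p - {0\<^sub>v p}. coset_count T i (B *\<^sub>v v) * nonparallel_count TYPE('a) p (Suc 0) v)"
    unfolding card_word_pairs[OF T B F]
    by (rule sum.mono_neutral_right) (auto simp: finite_carrier_vec nonparallel_count_1)
  also have "\<dots> = (\<Sum>v\<in>carrier_vec p - {0\<^sub>v p}. coset_count T i (B *\<^sub>v v))"
    by (intro sum.cong) (auto simp: nonparallel_count_1)
  finally show ?thesis unfolding A1_def word_pairs_def by simp
qed

text \<open>
  The coefficients depend on $p$, $j$ and the field, but not on the design. This is what allows two
  designs to be compared. The unit vector stands for an arbitrary nonzero vector.
\<close>

lemma card_word_pairs_linear:
  "real (card (word_pairs T F i j)) / real (CARD('a) - 1)
     = real (nonparallel_count TYPE('a) p j (0\<^sub>v p)) * A0 T i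
     + real (nonparallel_count TYPE('a) p j (unit_vec p 0)) * A1 T F i"
proof -
  have c: "nonparallel_count TYPE('a) p j v = nonparallel_count TYPE('a) p j (unit_vec p 0)"
    if "v \<in> carrier_vec p - {0\<^sub>v p}" for v
  proof (rule nonparallel_count_nonzero_eq[OF that])
    have "p \<noteq> 0" using that by (auto intro: eq_vecI)
    then have "(unit_vec p 0 :: 'a vec) $ 0 \<noteq> 0\<^sub>v p $ 0" by simp
    then show "(unit_vec p 0 :: 'a vec) \<in> carrier_vec p - {0\<^sub>v p}" by auto
  qed
  have "card (word_pairs T F i j)
      = coset_count T i (B *\<^sub>v 0\<^sub>v p) * nonparallel_count TYPE('a) p j (0\<^sub>v p)
      + (\<Sum>v\<in>carrier_vec p - {0\<^sub>v p}. coset_count T i (B *\<^sub>v v) * nonparallel_count TYPE('a) p j v)"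
    unfolding card_word_pairs[OF T B F] by (rule sum.remove) (auto simp: finite_carrier_vec)
  also have "(\<Sum>v\<in>carrier_vec p - {0\<^sub>v p}. coset_count T i (B *\<^sub>v v) * nonparallel_count TYPE('a) p j v)
      = (\<Sum>v\<in>carrier_vec p - {0\<^sub>v p}. coset_count T i (B *\<^sub>v v)) * nonparallel_count TYPE('a) p j (unit_vec p 0)"
    unfolding sum_distrib_right by (intro sum.cong refl) (simp only: c)
  finally show ?thesis
    unfolding A0_eq_coset_count[OF T] A1_eq_coset_count mult_zero_vec[OF B]
    by (simp add: add_divide_distrib mult.commute)
qed

lemma block_effects_carrier: "F \<in> carrier_mat m (card (normalized_vecs p :: 'a vec set))"
proof -
  obtain ls where "distinct ls" "set ls = normalized_vecs p"
    and F_eq: "F = mat_of_cols (dim_row B) (map (\<lambda>l. B *\<^sub>v l) ls)"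
    using F unfolding block_effects_def by blast
  then have l: "length ls = card (normalized_vecs p :: 'a vec set)" using distinct_card by metis
  show ?thesis
  proof (rule carrier_matI)
    show "dim_row F = m" using carrier_matD(1)[OF B] unfolding F_eq by simp
    show "dim_col F = card (normalized_vecs p :: 'a vec set)" unfolding F_eq l[symmetric] by simp
  qed
qed

lemma A0_unblocked:
  "A0 (unblocked_gen T F) d =
     (\<Sum>j\<le>d. real (nonparallel_count TYPE('a) p j (0\<^sub>v p)) * A0 T (d - j)
           + real (nonparallel_count TYPE('a) p j (unit_vec p 0)) * A1 T F (d - j))"
proof -
  have "A0 (unblocked_gen T F) d
      = real (\<Sum>j\<le>d. card (word_pairs T F (d - j) j)) / real (CARD('a) - 1)"
    using card_unblocked_words[OF T block_effects_carrier, of d]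
      unblocked_gen_carrier[OF T block_effects_carrier]
    unfolding A0_def by simp
  also have "\<dots> = (\<Sum>j\<le>d. real (card (word_pairs T F (d - j) j)) / real (CARD('a) - 1))"
    by (simp add: sum_divide_distrib)
  finally show ?thesis by (simp only: card_word_pairs_linear)
qed

text \<open>
  Every term of the remaining sum has length below $d$, so it is already fixed when the entry at
  $d + 1$ is compared.
\<close>

lemma A0_unblocked_Suc:
  assumes "1 \<le> p"
  shows "A0 (unblocked_gen T F) (Suc d) = A0 T (Suc d) + A1 T F d +
     (\<Sum>j<d. real (nonparallel_count TYPE('a) p (j + 2) (0\<^sub>v p)) * A0 T (d - Suc j)
           + real (nonparallel_count TYPE('a) p (j + 2) (unit_vec p 0)) * A1 T F (d - Suc j))"
proof -
  have "(unit_vec p 0 :: 'a vec) $ 0 \<noteq> 0\<^sub>v p $ 0" using assms by simp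
  then have "(unit_vec p 0 :: 'a vec) \<noteq> 0\<^sub>v p" by auto
  moreover have shift: "(\<Sum>j\<le>Suc d. f j) = f 0 + f (Suc 0) + (\<Sum>j<d. f (j + 2))" for f :: "nat \<Rightarrow> real"
    unfolding sum.atMost_shift sum.lessThan_Suc_shift by simp
  ultimately show ?thesis
    using nonparallel_count_1[of "0\<^sub>v p :: 'a vec" p] nonparallel_count_1[of "unit_vec p 0 :: 'a vec" p]
    by (simp only: A0_unblocked shift) (simp add: nonparallel_count_0)
qed

end

section \<open>Rank conditions\<close>

lemma (in vec_space) maximal_indpt_subset:
  assumes "finite A"
  obtains S where "maximal S (\<lambda>S. S \<subseteq> A \<and> lin_indpt S)"
proof -
  have "lin_indpt {}" by (auto simp: lin_dep_def)
  then show ?thesis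
    using that maximal_exists_superset[OF assms, of "\<lambda>S. S \<subseteq> A \<and> lin_indpt S" "{}"] by blast
qed

lemma full_col_rank_injective:
  fixes B :: "'a::{field,finite} mat"
  assumes B: "B \<in> carrier_mat m p" and rank: "vec_space.rank m B = p"
    and v: "v \<in> carrier_vec p" "B *\<^sub>v v = 0\<^sub>v m"
  shows "v = 0\<^sub>v p"
proof (rule ccontr)
  assume nz: "v \<noteq> 0\<^sub>v p"
  interpret vec_space "TYPE('a)" m .
  have "distinct (cols B)"
  proof (rule card_distinct, rule antisym[OF card_length])
    obtain S where S: "maximal S (\<lambda>S. S \<subseteq> set (cols B) \<and> lin_indpt S)"
      using maximal_indpt_subset[OF finite_set] by blast
    then have "card S \<le> card (set (cols B))"
      by (intro card_mono) (auto simp: maximal_def)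
    then show "length (cols B) \<le> card (set (cols B))"
      using rank_card_indpt[OF B S] rank B by simp
  qed
  then show False
    using full_rank_lin_indpt[OF B rank] lin_depI[OF B v(1) nz v(2)] by blast
qed

text \<open>
  Needed to let the unblocked version of every competing design enter the comparison class of
  $D_{un}$.
\<close>

lemma regular_unblocked_gen:
  fixes T F :: "'a::{field,finite} mat"
  assumes T: "regular_design n k T" and F: "F \<in> carrier_mat (n - k) l"
  shows "regular_design (n + l) (k + l) (unblocked_gen T F)"
proof -
  let ?m = "n - k"
  interpret vec_space "TYPE('a)" ?m .
  have Tc: "T \<in> carrier_mat ?m n" and rank: "rank T = ?m"
    using T by (auto simp: regular_design_def)
  have U: "unblocked_gen T F \<in> carrier_mat ?m (n + l)"
    by (rule unblocked_gen_carrier[OF Tc F])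
  have cols_U: "set (cols (unblocked_gen T F)) = set (cols T) \<union> set (cols F)"
    using Tc F cols_dim[of T] cols_dim[of F] by (simp add: unblocked_gen_def)
  have "?m \<le> rank (unblocked_gen T F)"
  proof -
    obtain S where S: "maximal S (\<lambda>S. S \<subseteq> set (cols T) \<and> lin_indpt S)" using maximal_indpt_subset[OF finite_set] by blast
    then have "S \<subseteq> set (cols (unblocked_gen T F))" "lin_indpt S"
      unfolding cols_U by (auto simp: maximal_def)
    then have "card S \<le> rank (unblocked_gen T F)" using rank_ge_card_indpt[OF U] by blast
    then show ?thesis using rank_card_indpt[OF Tc S] rank by simp
  qed
  moreover have "rank (unblocked_gen T F) \<le> ?m"
  proof -
    obtain S where S: "maximal S (\<lambda>S. S \<subseteq> set (cols (unblocked_gen T F)) \<and> lin_indpt S)"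
      using maximal_indpt_subset[OF finite_set] by blast
    then have "S \<subseteq> carrier_vec ?m" "lin_indpt S"
      using U cols_dim[of "unblocked_gen T F"] by (auto simp: maximal_def)
    then have "card S \<le> ?m" using li_le_dim(2)[of S] dim_is_n by simp
    then show ?thesis using rank_card_indpt[OF U S] by simp
  qed
  ultimately show ?thesis using U by (simp add: regular_design_def)
qed

section \<open>Minimum aberration of blocked designs\<close>

lemma hamming_wt_0_iff:
  assumes "w \<in> carrier_vec n"
  shows "hamming_wt w = 0 \<longleftrightarrow> w = 0\<^sub>v n"
proof
  assume "hamming_wt w = 0"
  then show "w = 0\<^sub>v n" using assms by (intro eq_vecI) (auto simp: hamming_wt_def)
qed (simp add: hamming_wt_def)

lemma coset_count_weight_0:
  fixes T :: "'a::{field,finite} mat"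
  assumes "T \<in> carrier_mat m n" "x \<in> carrier_vec m"
  shows "coset_count T 0 x = (if x = 0\<^sub>v m then 1 else 0)"
proof -
  have "T *\<^sub>v 0\<^sub>v n + x = x" using mult_zero_vec[OF assms(1)] assms(2) by simp
  then have "{w \<in> carrier_vec (dim_col T). T *\<^sub>v w + x = 0\<^sub>v (dim_row T) \<and> hamming_wt w = 0}
      = (if x = 0\<^sub>v m then {0\<^sub>v n} else {})"
    using assms by (auto simp: hamming_wt_0_iff[of _ n])
  then show ?thesis by (simp add: coset_count_def)
qed

text \<open>
  The only word of length 0 is $w = 0$: it is a defining word, and it is not confounded with any
  block effect because $B$ has full column rank. The other values vanish for RME designs.
\<close>

lemma rme_small_lengths:
  fixes T B F T' B' F' :: "'a::{field,finite} mat"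
  assumes D: "rme_design n k p T B F" "rme_design n k p T' B' F'"
  shows "i \<le> 2 \<Longrightarrow> A0 T i = A0 T' i" "i \<le> 1 \<Longrightarrow> A1 T F i = A1 T' F' i"
proof -
  have A0_0: "A0 T 0 = 1 / real (CARD('a) - 1)" and A1_0: "A1 T F 0 = 0"
    if "rme_design n k p T B F" for T B F :: "'a mat"
  proof -
    have T: "T \<in> carrier_mat (n - k) n" and B: "B \<in> carrier_mat (n - k) p"
      and rank: "vec_space.rank (n - k) B = p" and F: "block_effects p B F"
      using that by (auto simp: rme_design_def regular_blocked_design_def regular_design_def)
    show "A0 T 0 = 1 / real (CARD('a) - 1)"
      by (simp add: A0_eq_coset_count[OF T] coset_count_weight_0[OF T])
    have "coset_count T 0 (B *\<^sub>v v) = 0" if "v \<in> carrier_vec p - {0\<^sub>v p}" for v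
      using that full_col_rank_injective[OF B rank, of v] mult_mat_vec_carrier[OF B, of v]
      by (auto simp: coset_count_weight_0[OF T])
    then show "A1 T F 0 = 0" by (simp add: A1_eq_coset_count[OF T B F])
  qed
  show "A0 T i = A0 T' i" if "i \<le> 2"
  proof -
    from that consider "i = 0" | "i = 1" | "i = 2" by linarith
    then show ?thesis using D A0_0[OF D(1)] A0_0[OF D(2)] by cases (auto simp: rme_design_def)
  qed
  show "A1 T F i = A1 T' F' i" if "i \<le> 1"
  proof -
    from that consider "i = 0" | "i = 1" by linarith
    then show ?thesis using D A1_0[OF D(1)] A1_0[OF D(2)] by cases (auto simp: rme_design_def)
  qed
qed

lemma min_aberrationD:
  fixes T T' :: "'a::{field,finite} mat"
  assumes "min_aberration n k T" "regular_design n k T'" "A0 T 0 = A0 T' 0"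
    and "\<And>i. i < m \<Longrightarrow> A0 T i = A0 T' i"
  shows "A0 T m \<le> A0 T' m"
proof (cases m)
  case (Suc j)
  have "lex_le (\<lambda>j. A0 T (j + 1)) (\<lambda>j. A0 T' (j + 1))"
    using assms(1,2) by (auto simp: min_aberration_def)
  from lex_leD[OF this, of j] show ?thesis using assms(4) Suc by simp
qed (simp add: assms(3))

text \<open>
  Under the assumptions the two unblocked patterns agree up to length $m$, so minimum aberration of
  $D_{un}$ bounds the entry at $m + 1$, in which all but two summands agree.
\<close>

lemma min_aberration_sum_le:
  fixes T B F T' B' F' :: "'a::{field,finite} mat"
  assumes p: "1 \<le> p" and D: "rme_design n k p T B F" and D': "rme_design n k p T' B' F'"
    and un: "min_aberration (n + num_effects CARD('a) p) (k + num_effects CARD('a) p) (unblocked_gen T F)"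
    and a: "\<And>i. i \<le> m \<Longrightarrow> A0 T i = A0 T' i" and b: "\<And>i. i < m \<Longrightarrow> A1 T F i = A1 T' F' i"
  shows "A0 T (Suc m) + A1 T F m \<le> A0 T' (Suc m) + A1 T' F' m"
proof -
  have T: "T \<in> carrier_mat (n - k) n" and B: "B \<in> carrier_mat (n - k) p" and F: "block_effects p B F"
    using D by (auto simp: rme_design_def regular_blocked_design_def regular_design_def)
  have T': "T' \<in> carrier_mat (n - k) n" and B': "B' \<in> carrier_mat (n - k) p" and F': "block_effects p B' F'"
    and reg': "regular_design n k T'"
    using D' by (auto simp: rme_design_def regular_blocked_design_def regular_design_def)
  let ?l = "card (normalized_vecs p :: 'a vec set)"
  \<comment> \<open>Both numbers give the number of columns of $F$.\<close>
  have "num_effects CARD('a) p = ?l"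
    using un unblocked_gen_carrier[OF T block_effects_carrier[OF T B F]]
    unfolding min_aberration_def regular_design_def by (metis add_left_cancel carrier_matD(2))
  then have reg_un: "regular_design (n + num_effects CARD('a) p) (k + num_effects CARD('a) p) (unblocked_gen T' F')"
    using regular_unblocked_gen[OF reg' block_effects_carrier[OF T' B' F']] by simp
  note un_Suc = A0_unblocked_Suc[OF T B F p] A0_unblocked_Suc[OF T' B' F' p]
  have rest: "(\<Sum>j<d. real (nonparallel_count TYPE('a) p (j + 2) (0\<^sub>v p)) * A0 T (d - Suc j)
           + real (nonparallel_count TYPE('a) p (j + 2) (unit_vec p 0)) * A1 T F (d - Suc j))
     = (\<Sum>j<d. real (nonparallel_count TYPE('a) p (j + 2) (0\<^sub>v p)) * A0 T' (d - Suc j)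
           + real (nonparallel_count TYPE('a) p (j + 2) (unit_vec p 0)) * A1 T' F' (d - Suc j))"
    if "d \<le> m" for d
    using that by (intro sum.cong refl) (simp add: a b)
  have un_0: "A0 (unblocked_gen T F) 0 = A0 (unblocked_gen T' F') 0"
    using a[of 0] rme_small_lengths(2)[OF D D', of 0]
    unfolding A0_unblocked[OF T B F] A0_unblocked[OF T' B' F'] by simp
  have "A0 (unblocked_gen T F) (Suc m) \<le> A0 (unblocked_gen T' F') (Suc m)"
  proof (rule min_aberrationD[OF un reg_un un_0])
    fix i assume i: "i < Suc m"
    show "A0 (unblocked_gen T F) i = A0 (unblocked_gen T' F') i"
    proof (cases i)
      case (Suc d)
      then show ?thesis using i a b rest[of d] by (simp add: un_Suc)
    qed (simp add: un_0)
  qed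
  then show ?thesis using rest[of m] by (simp add: un_Suc)
qed

theorem theorem6:
  fixes T B F :: "'a::{field,finite} mat" and n k p :: nat
  assumes "k < n" and "1 \<le> p"
    and "rme_design n k p T B F"
    and "min_aberration n k T"
    and "min_aberration (n + num_effects CARD('a) p) (k + num_effects CARD('a) p)
           (unblocked_gen T F)"
  shows "blocked_min_aberration W_scf n k p T B F
       \<and> blocked_min_aberration W_1 n k p T B F
       \<and> blocked_min_aberration W_2 n k p T B F
       \<and> blocked_min_aberration W_cc n k p T B F"
proof -
  have "lex_le (W_scf T F) (W_scf T' F') \<and> lex_le (W_1 T F) (W_1 T' F') \<and>
        lex_le (W_2 T F) (W_2 T' F') \<and> lex_le (W_cc T F) (W_cc T' F')"
    if D': "rme_design n k p T' B' F'" for T' B' F' :: "'a mat"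
  proof -
    note small = rme_small_lengths[OF assms(3) D']
    have reg': "regular_design n k T'"
      using D' by (simp add: rme_design_def regular_blocked_design_def)
    have A0_min: "A0 T m \<le> A0 T' m" if "\<And>i. i < m \<Longrightarrow> A0 T i = A0 T' i" for m
      using that by (rule min_aberrationD[OF assms(4) reg' small(1)[OF zero_le]])
    have sum_min: "A0 T (Suc m) + A1 T F m \<le> A0 T' (Suc m) + A1 T' F' m"
      if "\<And>i. i \<le> m \<Longrightarrow> A0 T i = A0 T' i" "\<And>i. i < m \<Longrightarrow> A1 T F i = A1 T' F' i" for m
      using that by (rule min_aberration_sum_le[OF assms(2,3) D' assms(5)])
    show ?thesis
      by (intro conjI; rule lex_le_W_scf lex_le_W_1 lex_le_W_2 lex_le_W_cc; fact small A0_min sum_min)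
  qed
  then show ?thesis using assms(3) by (simp add: blocked_min_aberration_def)
qed

end
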